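(* Let $\mathbf{L}=\langle L,\leq\rangle$ be a complete algebraic lattice with $K$ its set of compact elements, let $S$ be a compact $L$-parameterization, and let $\Sigma$ be a set of formulas. For all $a,b\in K$: $\Sigma\vdash a\Rightarrow b$ if and only if $b\leq C_\Sigma(a)$.
   Context: An isotone Galois connection in $\mathbf{L}$ is a pair $\langle f,h\rangle$ of maps $L\to L$ with $f(a)\leq b$ iff $a\leq h(b)$. An $L$-parameterization is a set $S$ of isotone Galois connections in $\mathbf{L}$ containing $\langle \mathrm{id},\mathrm{id}\rangle$; it is compact if $f(a)\in K$ for all $a\in K$ and $\langle f,h\rangle\in S$. A formula is a pair $\langle a,b\rangle\in K\times K$ written $a\Rightarrow b$. The $S$-inference system consists of the rules, for all $a,b,c,d\in K$ and $\langle f,h\rangle\in S$: (1) infer $a\vee b\Rightarrow b$ (no premises); (2) from $a\Rightarrow b$ and $b\vee c\Rightarrow d$ infer $a\vee c\Rightarrow d$; (3) from $a\Rightarrow b$ infer $f(a)\Rightarrow f(b)$. $\Sigma\vdash a\Rightarrow b$ means there is a finite sequence of formulas ending in $a\Rightarrow b$ each of which belongs to $\Sigma$ or results from earlier ones by one application of a rule. $C_\Sigma(a)=\bigvee\{b\in K;\ \Sigma\vdash c\Rightarrow b$ for some $c\in K$ with $c\leq a\}$ for $a\in L$. *)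

theory Defs
  imports Main
begin

context complete_lattice
begin

text \<open>Compactness in the order-theoretic sense (unrelated to topological compactness).\<close>

definition compact_elements :: "'a set" where
  "compact_elements =
    {k. \<forall>A. k \<le> Sup A \<longrightarrow> (\<exists>B. finite B \<and> B \<subseteq> A \<and> k \<le> Sup B)}"

end

class algebraic_lattice = complete_lattice +
  assumes algebraic: "\<exists>A. A \<subseteq> compact_elements \<and> x = Sup A"

definition isotone_galois_connection ::
    "('a::order \<Rightarrow> 'a) \<times> ('a \<Rightarrow> 'a) \<Rightarrow> bool" where
  "isotone_galois_connection = (\<lambda>(f, h). \<forall>a b. f a \<le> b \<longleftrightarrow> a \<le> h b)"

definition parameterization ::
    "(('a::order \<Rightarrow> 'a) \<times> ('a \<Rightarrow> 'a)) set \<Rightarrow> bool" where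
  "parameterization S \<longleftrightarrow> (\<forall>p\<in>S. isotone_galois_connection p) \<and> (id, id) \<in> S"

definition compact_parameterization ::
    "(('a::complete_lattice \<Rightarrow> 'a) \<times> ('a \<Rightarrow> 'a)) set \<Rightarrow> bool" where
  "compact_parameterization S \<longleftrightarrow> parameterization S \<and>
    (\<forall>a\<in>compact_elements. \<forall>(f, h)\<in>S. f a \<in> compact_elements)"

text \<open>A formula \<open>a \<Rightarrow> b\<close> is the pair \<open>(a, b)\<close>, with both components compact.\<close>

definition formulas :: "('a::complete_lattice \<times> 'a) set" where
  "formulas = compact_elements \<times> compact_elements"

text \<open>\<open>inference_rule S P \<phi>\<close>: the formula \<open>\<phi>\<close> results from the set of premises \<open>P\<close>
  by one application of a rule of the \<open>S\<close>-inference system.\<close>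

inductive inference_rule ::
    "(('a::complete_lattice \<Rightarrow> 'a) \<times> ('a \<Rightarrow> 'a)) set
      \<Rightarrow> ('a \<times> 'a) set \<Rightarrow> 'a \<times> 'a \<Rightarrow> bool" for S where
  axiom: "a \<in> compact_elements \<Longrightarrow> b \<in> compact_elements
    \<Longrightarrow> inference_rule S {} (sup a b, b)"
| cut: "a \<in> compact_elements \<Longrightarrow> b \<in> compact_elements
    \<Longrightarrow> c \<in> compact_elements \<Longrightarrow> d \<in> compact_elements
    \<Longrightarrow> inference_rule S {(a, b), (sup b c, d)} (sup a c, d)"
| app: "a \<in> compact_elements \<Longrightarrow> b \<in> compact_elements \<Longrightarrow> (f, h) \<in> S
    \<Longrightarrow> inference_rule S {(a, b)} (f a, f b)"

definition derivation ::
    "(('a::complete_lattice \<Rightarrow> 'a) \<times> ('a \<Rightarrow> 'a)) set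
      \<Rightarrow> ('a \<times> 'a) set \<Rightarrow> ('a \<times> 'a) list \<Rightarrow> bool" where
  "derivation S \<Sigma> \<phi>s \<longleftrightarrow>
    (\<forall>i<length \<phi>s. \<phi>s ! i \<in> \<Sigma> \<or> (\<exists>P\<subseteq>set (take i \<phi>s). inference_rule S P (\<phi>s ! i)))"

definition provable ::
    "(('a::complete_lattice \<Rightarrow> 'a) \<times> ('a \<Rightarrow> 'a)) set
      \<Rightarrow> ('a \<times> 'a) set \<Rightarrow> 'a \<times> 'a \<Rightarrow> bool" where
  "provable S \<Sigma> \<phi> \<longleftrightarrow> (\<exists>\<phi>s. \<phi>s \<noteq> [] \<and> last \<phi>s = \<phi> \<and> derivation S \<Sigma> \<phi>s)"

definition C_op ::
    "(('a::complete_lattice \<Rightarrow> 'a) \<times> ('a \<Rightarrow> 'a)) set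
      \<Rightarrow> ('a \<times> 'a) set \<Rightarrow> 'a \<Rightarrow> 'a" where
  "C_op S \<Sigma> a = Sup {b \<in> compact_elements.
    \<exists>c\<in>compact_elements. c \<le> a \<and> provable S \<Sigma> (c, b)}"

end

theory Submission
  imports Defs
begin

text \<open>The forward direction is immediate. Conversely, compactness of \<open>b\<close> yields finitely many
  compact \<open>b\<^sub>i\<close> whose join dominates \<open>b\<close>, with \<open>c\<^sub>i \<Rightarrow> b\<^sub>i\<close> provable for some \<open>c\<^sub>i \<le> a\<close>. Weakening
  gives \<open>a \<Rightarrow> b\<^sub>i\<close>, two cuts per step combine these into \<open>a \<Rightarrow> \<Squnion> b\<^sub>i\<close>, and a last cut against the
  axiom \<open>\<Squnion> b\<^sub>i \<Rightarrow> b\<close> gives \<open>a \<Rightarrow> b\<close>.\<close>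

lemma compact_elementsE:
  assumes "k \<in> compact_elements" "k \<le> Sup A"
  obtains B where "finite B" "B \<subseteq> A" "k \<le> Sup B"
  using assms unfolding compact_elements_def by blast

lemma bot_compact: "(bot :: 'a::complete_lattice) \<in> compact_elements"
  unfolding compact_elements_def by auto

lemma sup_compact:
  fixes a b :: "'a::complete_lattice"
  assumes "a \<in> compact_elements" "b \<in> compact_elements"
  shows "sup a b \<in> compact_elements"
  unfolding compact_elements_def
proof (intro CollectI allI impI)
  fix A :: "'a set"
  assume le: "sup a b \<le> Sup A"
  then have "a \<le> Sup A" "b \<le> Sup A" by simp_all
  with assms obtain B C where B: "finite B" "B \<subseteq> A" "a \<le> Sup B"
    and C: "finite C" "C \<subseteq> A" "b \<le> Sup C"
    by (metis compact_elementsE)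
  have "sup a b \<le> Sup (B \<union> C)"
    using B(3) C(3) by (simp add: Sup_union_distrib le_supI1 le_supI2)
  with B C show "\<exists>B. finite B \<and> B \<subseteq> A \<and> sup a b \<le> Sup B"
    by (intro exI[of _ "B \<union> C"]) simp
qed

lemma Sup_finite_compact:
  fixes B :: "'a::complete_lattice set"
  assumes "finite B" "B \<subseteq> compact_elements"
  shows "Sup B \<in> compact_elements"
  using assms by (induction B) (simp_all add: bot_compact sup_compact)

text \<open>Premises of an entry of \<open>ys\<close> are sought among the earlier entries, and
  putting \<open>xs\<close> in front only enlarges that set.\<close>

lemma derivation_append:
  assumes "derivation S \<Sigma> xs" "derivation S \<Sigma> ys"
  shows "derivation S \<Sigma> (xs @ ys)"
  unfolding derivation_def
proof (intro allI impI)
  fix i assume i: "i < length (xs @ ys)"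
  show "(xs @ ys) ! i \<in> \<Sigma> \<or>
    (\<exists>P\<subseteq>set (take i (xs @ ys)). inference_rule S P ((xs @ ys) ! i))"
  proof (cases "i < length xs")
    case True
    then show ?thesis
      using assms(1) by (simp add: derivation_def nth_append)
  next
    case False
    then have "ys ! (i - length xs) \<in> \<Sigma> \<or>
      (\<exists>P\<subseteq>set (take (i - length xs) ys). inference_rule S P (ys ! (i - length xs)))"
      using assms(2) i by (simp add: derivation_def)
    with False show ?thesis
      by (auto simp: nth_append)
  qed
qed

lemma derivation_snoc:
  assumes "derivation S \<Sigma> xs" "P \<subseteq> set xs" "inference_rule S P \<phi>"
  shows "derivation S \<Sigma> (xs @ [\<phi>])"
  using assms by (auto simp: derivation_def nth_append less_Suc_eq)

text \<open>A rule takes its premises from a single sequence, so separate derivations of the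
  premises are concatenated into one.\<close>

lemma derivation_of_finite:
  assumes "finite P" "\<And>\<phi>. \<phi> \<in> P \<Longrightarrow> provable S \<Sigma> \<phi>"
  shows "\<exists>xs. P \<subseteq> set xs \<and> derivation S \<Sigma> xs"
  using assms
proof (induction P)
  case empty
  show ?case by (intro exI[of _ "[]"]) (simp add: derivation_def)
next
  case (insert \<phi> P)
  then obtain xs where xs: "P \<subseteq> set xs" "derivation S \<Sigma> xs" by auto
  from insert.prems obtain ys where ys: "\<phi> \<in> set ys" "derivation S \<Sigma> ys"
    unfolding provable_def by (metis insertI1 last_in_set)
  from xs ys show ?case
    by (intro exI[of _ "xs @ ys"]) (auto intro: derivation_append)
qed

text \<open>Passes from sequences to closure under the rules; from here on derivations are no longer
  handled explicitly.\<close>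

lemma provable_rule:
  assumes "inference_rule S P \<phi>" "finite P" "\<And>\<psi>. \<psi> \<in> P \<Longrightarrow> provable S \<Sigma> \<psi>"
  shows "provable S \<Sigma> \<phi>"
proof -
  obtain xs where "P \<subseteq> set xs" "derivation S \<Sigma> xs"
    using derivation_of_finite[OF assms(2,3)] by blast
  then have "derivation S \<Sigma> (xs @ [\<phi>])"
    using assms(1) by (blast intro: derivation_snoc)
  then show ?thesis
    unfolding provable_def by (intro exI[of _ "xs @ [\<phi>]"]) simp
qed

text \<open>For \<open>b \<le> a\<close> the axiom \<open>(sup a b, b)\<close> is literally
  \<open>(a, b)\<close>. This one form covers reflexivity and weakening.\<close>

lemma provable_ge:
  assumes "a \<in> compact_elements" "b \<in> compact_elements" "b \<le> a"
  shows "provable S \<Sigma> (a, b)"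
  using provable_rule[OF inference_rule.axiom[OF assms(1,2)]] assms(3)
  by (simp add: sup_absorb1)

lemma provable_cut:
  assumes "a \<in> compact_elements" "b \<in> compact_elements"
    "c \<in> compact_elements" "d \<in> compact_elements"
    and "provable S \<Sigma> (a, b)" "provable S \<Sigma> (sup b c, d)"
  shows "provable S \<Sigma> (sup a c, d)"
  using provable_rule[OF inference_rule.cut[OF assms(1-4)]] assms(5,6) by auto

lemma provable_trans:
  assumes "a \<in> compact_elements" "b \<in> compact_elements" "d \<in> compact_elements"
    and "provable S \<Sigma> (a, b)" "provable S \<Sigma> (b, d)"
  shows "provable S \<Sigma> (a, d)"
  \<comment> \<open>Transitivity is the cut whose side element \<open>c\<close> is
    \<open>bot\<close>, which is compact and vanishes from both joins.\<close>
  using provable_cut[OF assms(1,2) bot_compact assms(3,4)] assms(5) by simp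

lemma provable_sup:
  assumes "a \<in> compact_elements" "b \<in> compact_elements" "c \<in> compact_elements"
    and "provable S \<Sigma> (a, b)" "provable S \<Sigma> (a, c)"
  shows "provable S \<Sigma> (a, sup b c)"
proof -
  have bc: "sup b c \<in> compact_elements"
    using assms(2,3) by (rule sup_compact)
  have "provable S \<Sigma> (sup b c, sup b c)"
    using bc bc by (rule provable_ge) simp
  \<comment> \<open>Cutting \<open>a \<Rightarrow> b\<close> against the reflexive formula trades
    \<open>b\<close> for \<open>a\<close> on the left.\<close>
  with assms bc have "provable S \<Sigma> (sup a c, sup b c)"
    by (intro provable_cut[of a b c])
  \<comment> \<open>A cut replaces the left joinand, so \<open>c\<close> is moved there before it
    too is traded for \<open>a\<close>; idempotence then leaves \<open>a\<close>.\<close>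
  then have "provable S \<Sigma> (sup c a, sup b c)"
    by (simp add: sup_commute)
  with assms bc have "provable S \<Sigma> (sup a a, sup b c)"
    by (intro provable_cut[of a c a])
  then show ?thesis by simp
qed

lemma provable_Sup:
  assumes "finite B" "a \<in> compact_elements"
    and "\<And>b. b \<in> B \<Longrightarrow> b \<in> compact_elements \<and> provable S \<Sigma> (a, b)"
  shows "provable S \<Sigma> (a, Sup B)"
  using assms(1,3)
proof (induction B)
  case empty
  \<comment> \<open>The empty join is \<open>bot\<close>, which lies below \<open>a\<close>.\<close>
  show ?case using provable_ge[OF assms(2) bot_compact] by simp
next
  case (insert b B)
  then have "Sup B \<in> compact_elements"
    by (intro Sup_finite_compact) auto
  with insert assms(2) show ?case
    by (simp add: provable_sup)
qed

theorem theorem16: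
  fixes S :: "(('a::algebraic_lattice \<Rightarrow> 'a) \<times> ('a \<Rightarrow> 'a)) set"
    and \<Sigma> :: "('a \<times> 'a) set"
    and a b :: 'a
  assumes "compact_parameterization S"
    and "\<Sigma> \<subseteq> formulas"
    and "a \<in> compact_elements"
    and "b \<in> compact_elements"
  shows "provable S \<Sigma> (a, b) \<longleftrightarrow> b \<le> C_op S \<Sigma> a"
proof
  assume "provable S \<Sigma> (a, b)"
  \<comment> \<open>\<open>b\<close> is itself a member of the joined set, with \<open>c = a\<close>
    as witness.\<close>
  with assms(3,4) show "b \<le> C_op S \<Sigma> a"
    unfolding C_op_def by (intro Sup_upper) auto
next
  let ?T = "{b \<in> compact_elements. \<exists>c\<in>compact_elements. c \<le> a \<and> provable S \<Sigma> (c, b)}"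
  assume "b \<le> C_op S \<Sigma> a"
  then have "b \<le> Sup ?T" by (simp only: C_op_def)
  with assms(4) obtain B where B: "finite B" "B \<subseteq> ?T" "b \<le> Sup B"
    by (rule compact_elementsE)
  have "x \<in> compact_elements \<and> provable S \<Sigma> (a, x)" if "x \<in> B" for x
  proof -
    from that B(2) obtain c where x: "x \<in> compact_elements"
      and c: "c \<in> compact_elements" "c \<le> a" "provable S \<Sigma> (c, x)"
      by blast
    have "provable S \<Sigma> (a, c)"
      using assms(3) c(1,2) by (rule provable_ge)
    with x show ?thesis
      using provable_trans[OF assms(3) c(1) x _ c(3)] by simp
  qed
  then have "provable S \<Sigma> (a, Sup B)"
    by (rule provable_Sup[OF B(1) assms(3)])
  \<comment> \<open>Finiteness of \<open>B\<close> matters here: the rules apply only to compact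
    elements, and a finite join of compact elements is compact.\<close>
  moreover have SupB: "Sup B \<in> compact_elements"
    using B(1,2) by (intro Sup_finite_compact) auto
  moreover have "provable S \<Sigma> (Sup B, b)"
    using SupB assms(4) B(3) by (rule provable_ge)
  ultimately show "provable S \<Sigma> (a, b)"
    using assms(3,4) by (intro provable_trans[of a "Sup B" b])
qed

end
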